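(* Let $\omega_{\alpha\beta\sigma}=-\omega_{\beta\alpha\sigma}$ (linearized spin connection) and $F_{\alpha\beta}=-F_{\beta\alpha}$ (Maxwell field strength) be real tensor fields on Minkowski space, and let $\epsilon$ be a constant Dirac spinor (an element of $\mathbb C^4$). Let $$E^{\mu\nu}=\frac1{16\pi}\,\varepsilon^{\mu\nu\rho\sigma}\,\omega_{\alpha\beta\sigma}\,\bar\epsilon\,\gamma_5\gamma_\rho\gamma^{\alpha\beta}\epsilon,\qquad H^{\mu\nu}=\frac{i}{16\pi}\,\varepsilon^{\mu\nu\rho\sigma}F_{\alpha\beta}\,\bar\epsilon\,\gamma_5\gamma_\rho\gamma^{\alpha\beta}\gamma_\sigma\epsilon,$$ and let $\hat E^{\mu\nu}=E^{\mu\nu}+H^{\mu\nu}$ be the complex Witten–Nester form. Then $$E^{\mu\nu}=\frac1{8\pi}\,\bar\epsilon\gamma^\lambda\epsilon\left(\omega^{\mu\nu}{}_\lambda+\delta^\mu_\lambda\,\omega^{\nu\rho}{}_\rho-\delta^\nu_\lambda\,\omega^{\mu\rho}{}_\rho\right)+\frac1{8\pi}\,\bar\epsilon\gamma^\lambda\gamma_5\epsilon\;\varepsilon^{\mu\nu\rho\sigma}\omega_{\lambda\rho\sigma},$$ $$H^{\mu\nu}=\frac{i}{4\pi}F^{\mu\nu}\,\bar\epsilon\epsilon+\frac{i}{8\pi}\,\varepsilon^{\mu\nu\rho\sigma}F_{\rho\sigma}\,\bar\epsilon\gamma_5\epsilon,$$ and consequently, for the surface integral over a closed two-surface at fixed time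 with area element $d\hat\Sigma_i$ (in particular, over the sphere at spatial infinity, when the integrals converge), $$\oint\hat E^{0i}\,d\hat\Sigma_i=\bar\epsilon\gamma^\lambda P_\lambda\epsilon+\bar\epsilon\gamma_5\gamma^\lambda K_\lambda\epsilon-i\,\bar\epsilon\,U\epsilon-i\,\bar\epsilon\gamma_5V\epsilon,$$ where $$P_\lambda=\frac1{8\pi}\oint\left(\omega^{0i}{}_\lambda+\delta^0_\lambda\,\omega^{i\rho}{}_\rho-\delta^i_\lambda\,\omega^{0\rho}{}_\rho\right)d\hat\Sigma_i,\qquad K_\lambda=\frac1{8\pi}\oint\varepsilon^{ijk}\omega_{\lambda jk}\,d\hat\Sigma_i,$$ $$U=-\frac1{4\pi}\oint F^{0i}\,d\hat\Sigma_i,\qquad V=\frac1{8\pi}\oint\varepsilon^{ijk}F_{jk}\,d\hat\Sigma_i .$$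
   Context: Signature $\eta_{\mu\nu}=\mathrm{diag}(-1,1,1,1)$, used to move indices (no distinction between flat and curved indices at linear order); $\varepsilon_{0123}=-\varepsilon^{0123}=1$, and $\varepsilon^{ijk}$ is the spatial alternating symbol with $\varepsilon^{123}=1$. The $\gamma_a$ are real $4\times4$ matrices with $\gamma_a\gamma_b+\gamma_b\gamma_a=2\eta_{ab}$, $\gamma^{\alpha\beta}=\frac12(\gamma^\alpha\gamma^\beta-\gamma^\beta\gamma^\alpha)$, $\gamma_5=\gamma_0\gamma_1\gamma_2\gamma_3$ ($\gamma_5^2=-1$), and $\bar\epsilon=\epsilon^\dagger\gamma_0$. The first two indices of $\omega_{\alpha\beta\sigma}$ are the Lorentz indices and the last is the form index. ($E^{\mu\nu}$ and $H^{\mu\nu}$ are the gravitational and Maxwell parts of the complex Nester form $\frac1{4\pi}\varepsilon^{\mu\nu\rho\sigma}\bar\epsilon\gamma_5\gamma_\rho\nabla_\sigma\epsilon$ for $\nabla_\sigma\epsilon=\partial_\sigma\epsilon+\frac14\omega_{\alpha\beta\sigma}\gamma^{\alpha\beta}\epsilon+\frac i4F_{\alpha\beta}\gamma^{\alpha\beta}\gamma_\sigma\epsilon$ with constant $\epsilon$.) *)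

theory Defs
  imports "HOL-Analysis.Analysis" "HOL-Combinatorics.Permutations"
begin

section \<open>Indices, metric and alternating symbols\<close>

text \<open>Spacetime indices range over the type \<^typ>\<open>4\<close>, whose elements are \<open>0, 1, 2, 3\<close>
  (arithmetic modulo 4); \<open>0\<close> is the time index.  Spatial indices range over the
  type \<^typ>\<open>3\<close>, whose elements are \<open>1, 2, 3\<close> (with \<open>3 = 0\<close>).\<close>

definition sp :: "3 \<Rightarrow> 4" where
  "sp i = (if i = 1 then 1 else if i = 2 then 2 else 3)"

definition event :: "real \<Rightarrow> real^3 \<Rightarrow> real^4" where
  "event t x = t *\<^sub>R axis 0 1 + (\<Sum>i\<in>UNIV. (x $ i) *\<^sub>R axis (sp i) 1)"

definition eta :: "4 \<Rightarrow> 4 \<Rightarrow> real" where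
  "eta \<mu> \<nu> = (if \<mu> = \<nu> then (if \<mu> = 0 then - 1 else 1) else 0)"

definition delta :: "4 \<Rightarrow> 4 \<Rightarrow> real" where
  "delta \<mu> \<nu> = (if \<mu> = \<nu> then 1 else 0)"

definition eps_down :: "4 \<Rightarrow> 4 \<Rightarrow> 4 \<Rightarrow> 4 \<Rightarrow> real" where
  "eps_down \<mu> \<nu> \<rho> \<sigma> =
     (let p = (\<lambda>a. if a = 0 then \<mu> else if a = 1 then \<nu> else if a = 2 then \<rho> else \<sigma>)
      in if p permutes UNIV then of_int (sign p) else 0)"

definition eps_up :: "4 \<Rightarrow> 4 \<Rightarrow> 4 \<Rightarrow> 4 \<Rightarrow> real" where
  "eps_up \<mu> \<nu> \<rho> \<sigma> = - eps_down \<mu> \<nu> \<rho> \<sigma>"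

definition eps3 :: "3 \<Rightarrow> 3 \<Rightarrow> 3 \<Rightarrow> real" where
  "eps3 i j k =
     (let p = (\<lambda>a. if a = 1 then i else if a = 2 then j else k)
      in if p permutes UNIV then of_int (sign p) else 0)"

definition raise2 :: "(4 \<Rightarrow> 4 \<Rightarrow> real) \<Rightarrow> 4 \<Rightarrow> 4 \<Rightarrow> real" where
  "raise2 T \<mu> \<nu> = (\<Sum>\<alpha>\<in>UNIV. \<Sum>\<beta>\<in>UNIV. eta \<mu> \<alpha> * eta \<nu> \<beta> * T \<alpha> \<beta>)"


section \<open>Gamma matrices and spinors\<close>

definition gamma_matrices :: "(4 \<Rightarrow> real^4^4) \<Rightarrow> bool" where
  "gamma_matrices \<gamma> \<longleftrightarrow> (\<forall>a b. \<gamma> a ** \<gamma> b + \<gamma> b ** \<gamma> a = (2 * eta a b) *\<^sub>R mat 1)"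

definition gamma_up :: "(4 \<Rightarrow> real^4^4) \<Rightarrow> 4 \<Rightarrow> real^4^4" where
  "gamma_up \<gamma> \<alpha> = (\<Sum>\<beta>\<in>UNIV. eta \<alpha> \<beta> *\<^sub>R \<gamma> \<beta>)"

definition gamma2_up :: "(4 \<Rightarrow> real^4^4) \<Rightarrow> 4 \<Rightarrow> 4 \<Rightarrow> real^4^4" where
  "gamma2_up \<gamma> \<alpha> \<beta> =
     (1/2) *\<^sub>R (gamma_up \<gamma> \<alpha> ** gamma_up \<gamma> \<beta> - gamma_up \<gamma> \<beta> ** gamma_up \<gamma> \<alpha>)"

definition gamma5 :: "(4 \<Rightarrow> real^4^4) \<Rightarrow> real^4^4" where
  "gamma5 \<gamma> = \<gamma> 0 ** \<gamma> 1 ** \<gamma> 2 ** \<gamma> 3"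

definition cmat :: "real^4^4 \<Rightarrow> complex^4^4" where
  "cmat A = (\<chi> i j. complex_of_real (A $ i $ j))"

definition spinor_bar :: "(4 \<Rightarrow> real^4^4) \<Rightarrow> complex^4 \<Rightarrow> complex^4" where
  "spinor_bar \<gamma> \<psi> = (\<chi> i. cnj (\<psi> $ i)) v* cmat (\<gamma> 0)"

text \<open>The bilinear \<open>\<psi>-bar A \<psi>\<close>.\<close>

definition sandwich :: "(4 \<Rightarrow> real^4^4) \<Rightarrow> complex^4 \<Rightarrow> real^4^4 \<Rightarrow> complex" where
  "sandwich \<gamma> \<psi> A = (\<Sum>i\<in>UNIV. spinor_bar \<gamma> \<psi> $ i * (cmat A *v \<psi>) $ i)"


section \<open>The Witten--Nester form\<close>

text \<open>Pointwise, as functions of the values \<open>w \<alpha> \<beta> \<sigma>\<close> of the spin connection (form index last)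
  and \<open>f \<alpha> \<beta>\<close> of the field strength, all indices down.\<close>

definition nester_E ::
  "(4 \<Rightarrow> real^4^4) \<Rightarrow> complex^4 \<Rightarrow> (4 \<Rightarrow> 4 \<Rightarrow> 4 \<Rightarrow> real) \<Rightarrow> 4 \<Rightarrow> 4 \<Rightarrow> complex" where
  "nester_E \<gamma> \<psi> w \<mu> \<nu> = 1 / (16 * pi) *
     (\<Sum>\<rho>\<in>UNIV. \<Sum>\<sigma>\<in>UNIV. \<Sum>\<alpha>\<in>UNIV. \<Sum>\<beta>\<in>UNIV.
        of_real (eps_up \<mu> \<nu> \<rho> \<sigma> * w \<alpha> \<beta> \<sigma>) *
        sandwich \<gamma> \<psi> (gamma5 \<gamma> ** \<gamma> \<rho> ** gamma2_up \<gamma> \<alpha> \<beta>))"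

definition nester_H ::
  "(4 \<Rightarrow> real^4^4) \<Rightarrow> complex^4 \<Rightarrow> (4 \<Rightarrow> 4 \<Rightarrow> real) \<Rightarrow> 4 \<Rightarrow> 4 \<Rightarrow> complex" where
  "nester_H \<gamma> \<psi> f \<mu> \<nu> = \<i> / (16 * pi) *
     (\<Sum>\<rho>\<in>UNIV. \<Sum>\<sigma>\<in>UNIV. \<Sum>\<alpha>\<in>UNIV. \<Sum>\<beta>\<in>UNIV.
        of_real (eps_up \<mu> \<nu> \<rho> \<sigma> * f \<alpha> \<beta>) *
        sandwich \<gamma> \<psi> (gamma5 \<gamma> ** \<gamma> \<rho> ** gamma2_up \<gamma> \<alpha> \<beta> ** \<gamma> \<sigma>))"

definition witten_nester ::
  "(4 \<Rightarrow> real^4^4) \<Rightarrow> complex^4 \<Rightarrow> (4 \<Rightarrow> 4 \<Rightarrow> 4 \<Rightarrow> real) \<Rightarrow> (4 \<Rightarrow> 4 \<Rightarrow> real) \<Rightarrow> 4 \<Rightarrow> 4 \<Rightarrow> complex" where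
  "witten_nester \<gamma> \<psi> w f \<mu> \<nu> = nester_E \<gamma> \<psi> w \<mu> \<nu> + nester_H \<gamma> \<psi> f \<mu> \<nu>"

text \<open>\<open>omega_bracket w \<mu> \<nu> \<kappa>\<close> is
  \<open>\<omega>\<^sup>\<mu>\<^sup>\<nu>\<^sub>\<kappa> + \<delta>\<^sup>\<mu>\<^sub>\<kappa> \<omega>\<^sup>\<nu>\<^sup>\<rho>\<^sub>\<rho> - \<delta>\<^sup>\<nu>\<^sub>\<kappa> \<omega>\<^sup>\<mu>\<^sup>\<rho>\<^sub>\<rho>\<close>.\<close>

definition omega_bracket :: "(4 \<Rightarrow> 4 \<Rightarrow> 4 \<Rightarrow> real) \<Rightarrow> 4 \<Rightarrow> 4 \<Rightarrow> 4 \<Rightarrow> real" where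
  "omega_bracket w \<mu> \<nu> \<kappa> =
     raise2 (\<lambda>\<alpha> \<beta>. w \<alpha> \<beta> \<kappa>) \<mu> \<nu>
     + delta \<mu> \<kappa> * (\<Sum>\<rho>\<in>UNIV. raise2 (\<lambda>\<alpha> \<beta>. w \<alpha> \<beta> \<rho>) \<nu> \<rho>)
     - delta \<nu> \<kappa> * (\<Sum>\<rho>\<in>UNIV. raise2 (\<lambda>\<alpha> \<beta>. w \<alpha> \<beta> \<rho>) \<mu> \<rho>)"


section \<open>Surface area and flux integrals\<close>

text \<open>Two-dimensional Hausdorff (outer) measure, normalised by \<open>\<pi>/4 * diameter\<^sup>2\<close> so that it is
  the usual area on \<open>C\<^sup>1\<close> surfaces.\<close>

definition hausdorff2_pre :: "real \<Rightarrow> 'a::metric_space set \<Rightarrow> ennreal" where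
  "hausdorff2_pre d A =
     (INF C\<in>{C :: nat \<Rightarrow> 'a set. A \<subseteq> (\<Union>k. C k) \<and> (\<forall>k. bounded (C k) \<and> diameter (C k) \<le> d)}.
        \<Sum>k. ennreal (pi / 4 * (diameter (C k))\<^sup>2))"

definition hausdorff2 :: "'a::metric_space set \<Rightarrow> ennreal" where
  "hausdorff2 A = (SUP d\<in>{0<..}. hausdorff2_pre d A)"

definition area_measure :: "(real^3) measure" where
  "area_measure = measure_of UNIV (sets borel) hausdorff2"

lemma space_area_measure [simp]: "space area_measure = UNIV"
  by (simp add: area_measure_def space_measure_of_conv)

lemma sets_area_measure [simp, measurable_cong]: "sets area_measure = sets borel"
  unfolding area_measure_def using sets.sets_measure_of_eq[of borel] by simp

text \<open>Value of \<^const>\<open>area_measure\<close>: Caratheodory's criterion for metric outer measures.\<close>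

lemma hausdorff2_pre_antimono: "d \<le> e \<Longrightarrow> hausdorff2_pre e A \<le> hausdorff2_pre d A"
  unfolding hausdorff2_pre_def by (rule INF_superset_mono) (auto intro: order_trans)

lemma hausdorff2_pre_mono: "A \<subseteq> B \<Longrightarrow> hausdorff2_pre d A \<le> hausdorff2_pre d B"
  unfolding hausdorff2_pre_def by (rule INF_superset_mono) auto

lemma hausdorff2_mono: "A \<subseteq> B \<Longrightarrow> hausdorff2 A \<le> hausdorff2 B"
  unfolding hausdorff2_def by (intro SUP_mono) (auto intro: hausdorff2_pre_mono)

lemma hausdorff2_pre_le: "0 < d \<Longrightarrow> hausdorff2_pre d A \<le> hausdorff2 A"
  unfolding hausdorff2_def by (rule SUP_upper) simp

lemma hausdorff2_empty [simp]: "hausdorff2 {} = 0"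
proof -
  have "hausdorff2_pre d ({}::'a set) \<le> 0" if "d > 0" for d
    unfolding hausdorff2_pre_def using that
    by (intro INF_lower2[of "\<lambda>_. {}"]) auto
  then have "hausdorff2 ({}::'a set) \<le> 0"
    unfolding hausdorff2_def by (intro SUP_least) auto
  then show ?thesis by simp
qed

lemma hausdorff2_pre_subadd:
  fixes A :: "nat \<Rightarrow> 'a::metric_space set"
  shows "hausdorff2_pre d (\<Union>i. A i) \<le> (\<Sum>i. hausdorff2_pre d (A i))"
proof (rule ennreal_le_epsilon)
  fix e :: real assume "0 < e" and fin: "(\<Sum>i. hausdorff2_pre d (A i)) < top"
  have "\<exists>C. A i \<subseteq> (\<Union>k. C k) \<and> (\<forall>k. bounded (C k) \<and> diameter (C k) \<le> d) \<and>
      (\<Sum>k. ennreal (pi / 4 * (diameter (C k))\<^sup>2)) \<le> hausdorff2_pre d (A i) + e * (1/2)^Suc i" for i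
  proof -
    have "hausdorff2_pre d (A i) < hausdorff2_pre d (A i) + e * (1/2)^Suc i"
      using \<open>0 < e\<close> ennreal_suminf_lessD[OF fin, of i]
        ennreal_add_left_cancel_less[of "hausdorff2_pre d (A i)" 0 "ennreal (e * (1/2)^Suc i)"]
      by (auto simp: less_top)
    then obtain C where "A i \<subseteq> (\<Union>k. C k)" "\<forall>k. bounded (C k) \<and> diameter (C k) \<le> d"
      "(\<Sum>k. ennreal (pi / 4 * (diameter (C k))\<^sup>2)) < hausdorff2_pre d (A i) + e * (1/2)^Suc i"
      unfolding hausdorff2_pre_def[of d "A i"] INF_less_iff by auto
    then show ?thesis by (auto intro: less_imp_le)
  qed
  then obtain C where C: "\<And>i. A i \<subseteq> (\<Union>k. C i k)"
    "\<And>i k. bounded (C i k)" "\<And>i k. diameter (C i k) \<le> d"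
    and le: "\<And>i. (\<Sum>k. ennreal (pi / 4 * (diameter (C i k))\<^sup>2)) \<le> hausdorff2_pre d (A i) + e * (1/2)^Suc i"
    by metis
  define D where "D = (\<lambda>n. case prod_decode n of (i, k) \<Rightarrow> C i k)"
  have "hausdorff2_pre d (\<Union>i. A i) \<le> (\<Sum>n. ennreal (pi / 4 * (diameter (D n))\<^sup>2))"
    unfolding hausdorff2_pre_def
  proof (rule INF_lower, safe)
    fix x i assume "x \<in> A i"
    with C(1) obtain k where "x \<in> C i k" by blast
    then have "x \<in> D (prod_encode (i, k))" by (simp add: D_def)
    then show "x \<in> (\<Union>n. D n)" by blast
  qed (auto simp: D_def C split: prod.split)
  also have "\<dots> = (\<Sum>i. \<Sum>k. ennreal (pi / 4 * (diameter (C i k))\<^sup>2))"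
    unfolding D_def
    by (rule suminf_ennreal_2dimen[where f = "\<lambda>p. ennreal (pi / 4 * (diameter (case p of (i, k) \<Rightarrow> C i k))\<^sup>2)"])
      (simp only: prod.case)
  also have "\<dots> \<le> (\<Sum>i. hausdorff2_pre d (A i) + e * (1/2)^Suc i)"
    by (intro suminf_le le) auto
  also have "\<dots> = (\<Sum>i. hausdorff2_pre d (A i) + ennreal e * ennreal ((1/2)^Suc i))"
    using \<open>0 < e\<close> by (simp only: ennreal_mult[symmetric] less_imp_le zero_le_power zero_le_divide_1_iff zero_le_numeral)
  also have "\<dots> = (\<Sum>i. hausdorff2_pre d (A i)) + (\<Sum>i. ennreal e * ennreal ((1/2)^Suc i))"
    by (rule suminf_add[symmetric]) auto
  also have "(\<Sum>i. ennreal e * ennreal ((1/2)^Suc i)) = ennreal e"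
    unfolding ennreal_suminf_cmult
    by (subst suminf_ennreal_eq[OF zero_le_power power_half_series]) auto
  finally show "hausdorff2_pre d (\<Union>i. A i) \<le> (\<Sum>i. hausdorff2_pre d (A i)) + ennreal e" .
qed

lemma hausdorff2_subadd:
  fixes A :: "nat \<Rightarrow> 'a::metric_space set"
  shows "hausdorff2 (\<Union>i. A i) \<le> (\<Sum>i. hausdorff2 (A i))"
  unfolding hausdorff2_def[of "\<Union>i. A i"]
proof (rule SUP_least)
  fix d :: real assume "d \<in> {0<..}"
  then have "(\<Sum>i. hausdorff2_pre d (A i)) \<le> (\<Sum>i. hausdorff2 (A i))"
    by (intro suminf_le hausdorff2_pre_le) auto
  then show "hausdorff2_pre d (\<Union>i. A i) \<le> (\<Sum>i. hausdorff2 (A i))"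
    using hausdorff2_pre_subadd order_trans by blast
qed

lemma hausdorff2_Un: "hausdorff2 (A \<union> B) \<le> hausdorff2 A + hausdorff2 B"
proof -
  have "hausdorff2 (\<Union>i. binaryset A B i) \<le> (\<Sum>i. hausdorff2 (binaryset A B i))"
    by (rule hausdorff2_subadd)
  then show ?thesis
    by (simp add: UN_binaryset_eq suminf_binaryset_eq)
qed

lemma hausdorff2_separated:
  fixes A B :: "'a::metric_space set"
  assumes "0 < s" and sep: "\<And>a b. a \<in> A \<Longrightarrow> b \<in> B \<Longrightarrow> s \<le> dist a b"
  shows "hausdorff2 A + hausdorff2 B \<le> hausdorff2 (A \<union> B)"
proof -
  have pre: "hausdorff2_pre d A + hausdorff2_pre d B \<le> hausdorff2_pre d (A \<union> B)"
    if d: "0 < d" "d < s" for d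
    unfolding hausdorff2_pre_def[of d "A \<union> B"]
  proof (rule INF_greatest, safe)
    fix C :: "nat \<Rightarrow> 'a set"
    assume cov: "A \<union> B \<subseteq> (\<Union>k. C k)" and C: "\<forall>k. bounded (C k) \<and> diameter (C k) \<le> d"
    define CA where "CA = (\<lambda>k. if C k \<inter> A = {} then {} else C k)"
    define CB where "CB = (\<lambda>k. if C k \<inter> B = {} then {} else C k)"
    have disj: "C k \<inter> A = {} \<or> C k \<inter> B = {}" for k
    proof (rule ccontr)
      assume "\<not> ?thesis"
      then obtain a b where ab: "a \<in> C k" "a \<in> A" "b \<in> C k" "b \<in> B" by blast
      then have "dist a b \<le> d"
        using C diameter_bounded_bound[of "C k" a b] order_trans by blast
      with sep[OF ab(2,4)] d show False by simp
    qed
    have "hausdorff2_pre d A \<le> (\<Sum>k. ennreal (pi / 4 * (diameter (CA k))\<^sup>2))"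
      unfolding hausdorff2_pre_def using cov C d
      by (intro INF_lower) (fastforce simp: CA_def split: if_splits)
    moreover have "hausdorff2_pre d B \<le> (\<Sum>k. ennreal (pi / 4 * (diameter (CB k))\<^sup>2))"
      unfolding hausdorff2_pre_def using cov C d
      by (intro INF_lower) (fastforce simp: CB_def split: if_splits)
    ultimately have "hausdorff2_pre d A + hausdorff2_pre d B \<le>
        (\<Sum>k. ennreal (pi / 4 * (diameter (CA k))\<^sup>2) + ennreal (pi / 4 * (diameter (CB k))\<^sup>2))"
      by (subst suminf_add[symmetric]) (auto intro: add_mono)
    also have "\<dots> \<le> (\<Sum>k. ennreal (pi / 4 * (diameter (C k))\<^sup>2))"
      using disj by (intro suminf_le) (auto simp: CA_def CB_def)
    finally show "hausdorff2_pre d A + hausdorff2_pre d B \<le> (\<Sum>k. ennreal (pi / 4 * (diameter (C k))\<^sup>2))" .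
  qed
  have "hausdorff2_pre d1 A + hausdorff2_pre d2 B \<le> hausdorff2 (A \<union> B)"
    if "0 < d1" "0 < d2" for d1 d2
  proof -
    define d where "d = min (min d1 d2) (s / 2)"
    have d: "0 < d" "d < s" "d \<le> d1" "d \<le> d2" using that \<open>0 < s\<close> by (auto simp: d_def)
    have "hausdorff2_pre d1 A + hausdorff2_pre d2 B \<le> hausdorff2_pre d A + hausdorff2_pre d B"
      using d by (intro add_mono hausdorff2_pre_antimono) auto
    also have "\<dots> \<le> hausdorff2 (A \<union> B)"
      using pre[OF d(1,2)] hausdorff2_pre_le[OF d(1)] order_trans by blast
    finally show ?thesis .
  qed
  then have "hausdorff2_pre d1 A + hausdorff2 B \<le> hausdorff2 (A \<union> B)" if "0 < d1" for d1
    using that ennreal_SUP_add_right[of "{0<..}" "hausdorff2_pre d1 A" "\<lambda>d. hausdorff2_pre d B"]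
    unfolding hausdorff2_def[of B] by (auto intro!: SUP_least)
  then show ?thesis
    using ennreal_SUP_add_left[of "{0::real<..}" "\<lambda>d. hausdorff2_pre d A" "hausdorff2 B"]
      SUP_least[of "{0::real<..}" "\<lambda>d. hausdorff2_pre d A + hausdorff2 B" "hausdorff2 (A \<union> B)"]
    unfolding hausdorff2_def[of A] by simp
qed

lemma hausdorff2_closed_split:
  fixes F A :: "'a::metric_space set"
  assumes "closed F"
  shows "hausdorff2 (A \<inter> F) + hausdorff2 (A - F) \<le> hausdorff2 A"
proof (cases "F = {} \<or> hausdorff2 A = top")
  case True
  then show ?thesis by auto
next
  case False
  then have "F \<noteq> {}" and fin: "hausdorff2 A < top" by (auto simp: less_top)
  define G where "G = (\<lambda>n::nat. {x \<in> A. 1 / real (Suc n) \<le> infdist x F})"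
  define R where "R = (\<lambda>n. G (Suc n) - G n)"
  have G_mono: "G m \<subseteq> G n" if "m \<le> n" for m n
  proof -
    have "1 / real (Suc n) \<le> 1 / real (Suc m)" using that by (intro frac_le) auto
    then show ?thesis unfolding G_def by (auto intro: order_trans)
  qed
  have "G n \<subseteq> A" "R n \<subseteq> A" for n by (auto simp: G_def R_def)
  have split: "hausdorff2 (A \<inter> F) + hausdorff2 (G n) \<le> hausdorff2 A" for n
  proof -
    have "1 / real (Suc n) \<le> dist a b" if "a \<in> A \<inter> F" "b \<in> G n" for a b
      using that infdist_le[of a F b] by (auto simp: G_def dist_commute)
    then have "hausdorff2 (A \<inter> F) + hausdorff2 (G n) \<le> hausdorff2 (A \<inter> F \<union> G n)"
      by (intro hausdorff2_separated[of "1 / real (Suc n)"]) auto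
    also have "\<dots> \<le> hausdorff2 A"
      using \<open>G n \<subseteq> A\<close> by (intro hausdorff2_mono) auto
    finally show ?thesis .
  qed
  have R_sep: "(\<Sum>k<n. hausdorff2 (R (2 * k + j))) \<le> hausdorff2 (\<Union>k<n. R (2 * k + j))" for n j
  proof (induction n)
    case (Suc n)
    show ?case
    proof (cases n)
      case 0
      then show ?thesis by (simp add: lessThan_Suc)
    next
      case (Suc m)
      define s where "s = 1 / real (2 * n + j) - 1 / real (2 * n + j + 1)"
      have "0 < s" using Suc by (simp add: s_def frac_less2)
      have "s \<le> dist a b" if a: "a \<in> (\<Union>k<n. R (2 * k + j))" and b: "b \<in> R (2 * n + j)" for a b
      proof -
        obtain k where k: "k < n" "a \<in> R (2 * k + j)" using a by auto
        have "Suc (2 * k + j) \<le> 2 * n + j - 1" using k by linarith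
        then have "a \<in> G (2 * n + j - 1)"
          using k G_mono[of "Suc (2 * k + j)" "2 * n + j - 1"] unfolding R_def
          by blast
        then have 1: "1 / real (2 * n + j) \<le> infdist a F"
          using Suc by (auto simp: G_def)
        have 2: "infdist b F < 1 / real (2 * n + j + 1)"
          using b by (auto simp: R_def G_def not_le add.commute)
        have "infdist a F \<le> infdist b F + dist a b" by (rule infdist_triangle)
        then show ?thesis using 1 2 by (simp add: s_def)
      qed
      then have "hausdorff2 (\<Union>k<n. R (2 * k + j)) + hausdorff2 (R (2 * n + j))
          \<le> hausdorff2 ((\<Union>k<n. R (2 * k + j)) \<union> R (2 * n + j))"
        by (rule hausdorff2_separated[OF \<open>0 < s\<close>])
      moreover have "(\<Union>k<n. R (2 * k + j)) \<union> R (2 * n + j) = (\<Union>k<Suc n. R (2 * k + j))"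
        by (auto simp: less_Suc_eq)
      ultimately show ?thesis
        using Suc.IH by (auto intro: order_trans add_mono)
    qed
  qed simp
  have R_fin: "(\<Sum>k. hausdorff2 (R (2 * k + j))) \<le> hausdorff2 A" for j
  proof (rule suminf_le_const)
    show "(\<Sum>k<n. hausdorff2 (R (2 * k + j))) \<le> hausdorff2 A" for n
      using R_sep[of j n] hausdorff2_mono[of "\<Union>k<n. R (2 * k + j)" A] \<open>\<And>n. R n \<subseteq> A\<close>
      by (meson UN_least order_trans)
  qed auto
  have "(\<Sum>n. hausdorff2 (R n)) < top"
  proof -
    have "(\<Sum>n<N. hausdorff2 (R n)) \<le> hausdorff2 A + hausdorff2 A" for N
    proof -
      have "(\<Sum>n<N. hausdorff2 (R n)) \<le> (\<Sum>n<2 * N. hausdorff2 (R n))"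
        by (intro sum_mono2) auto
      also have "\<dots> = (\<Sum>k<N. hausdorff2 (R (2 * k + 0))) + (\<Sum>k<N. hausdorff2 (R (2 * k + 1)))"
        by (induction N) (auto simp: algebra_simps)
      also have "\<dots> \<le> hausdorff2 A + hausdorff2 A"
        by (intro add_mono order_trans[OF sum_le_suminf R_fin]) auto
      finally show ?thesis .
    qed
    then have "(\<Sum>n. hausdorff2 (R n)) \<le> hausdorff2 A + hausdorff2 A"
      by (intro suminf_le_const) auto
    also have "\<dots> < top" using fin by simp
    finally show ?thesis .
  qed
  have cover: "hausdorff2 (A - F) \<le> hausdorff2 (G n) + (\<Sum>k. hausdorff2 (R (k + n)))" for n
  proof -
    have "A - F \<subseteq> G n \<union> (\<Union>k. R (k + n))"
    proof
      fix x assume x: "x \<in> A - F"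
      then have "0 < infdist x F"
        using \<open>closed F\<close> \<open>F \<noteq> {}\<close> by (simp add: infdist_pos_not_in_closed)
      then obtain m where "1 / real (Suc m) < infdist x F"
        by (metis inverse_eq_divide reals_Archimedean)
      then have m: "x \<in> G m" using x by (auto simp: G_def)
      show "x \<in> G n \<union> (\<Union>k. R (k + n))"
      proof (cases "x \<in> G n")
        case False
        define l where "l = (LEAST l. x \<in> G l)"
        have l: "x \<in> G l" "\<And>i. i < l \<Longrightarrow> x \<notin> G i"
          unfolding l_def using m by (auto intro: LeastI dest: not_less_Least)
        have "n < l" using False l(1) G_mono[of l n] by (meson not_le subsetD)
        then have "x \<in> R ((l - 1 - n) + n)" using l by (auto simp: R_def)
        then show ?thesis by blast
      qed simp
    qed
    then have "hausdorff2 (A - F) \<le> hausdorff2 (G n \<union> (\<Union>k. R (k + n)))"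
      by (rule hausdorff2_mono)
    also have "\<dots> \<le> hausdorff2 (G n) + hausdorff2 (\<Union>k. R (k + n))"
      by (rule hausdorff2_Un)
    also have "\<dots> \<le> hausdorff2 (G n) + (\<Sum>k. hausdorff2 (R (k + n)))"
      by (intro add_mono hausdorff2_subadd order_refl)
    finally show ?thesis .
  qed
  have bound: "hausdorff2 (A \<inter> F) + hausdorff2 (A - F) \<le> hausdorff2 A + (\<Sum>k. hausdorff2 (R (k + n)))" for n
  proof -
    have "hausdorff2 (A \<inter> F) + hausdorff2 (A - F)
        \<le> hausdorff2 (A \<inter> F) + (hausdorff2 (G n) + (\<Sum>k. hausdorff2 (R (k + n))))"
      by (intro add_mono cover order_refl)
    also have "\<dots> \<le> hausdorff2 A + (\<Sum>k. hausdorff2 (R (k + n)))"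
      unfolding add.assoc[symmetric] by (intro add_mono split order_refl)
    finally show ?thesis .
  qed
  define T where "T = (\<Sum>k. hausdorff2 (R k))"
  have "(\<Sum>k<n. hausdorff2 (R k)) + (hausdorff2 (A \<inter> F) + hausdorff2 (A - F)) \<le> T + hausdorff2 A" for n
  proof -
    have "(\<Sum>k<n. hausdorff2 (R k)) + (\<Sum>k. hausdorff2 (R (k + n))) = T"
      unfolding T_def by (subst suminf_offset[of _ n]) (auto simp: add.commute)
    then show ?thesis
      using add_mono[OF order_refl bound, of "\<Sum>k<n. hausdorff2 (R k)" n] by (simp add: ac_simps)
  qed
  moreover have "(\<lambda>n. (\<Sum>k<n. hausdorff2 (R k)) + (hausdorff2 (A \<inter> F) + hausdorff2 (A - F)))
      \<longlonglongrightarrow> T + (hausdorff2 (A \<inter> F) + hausdorff2 (A - F))"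
    unfolding T_def by (intro tendsto_add tendsto_const summable_LIMSEQ) auto
  ultimately have "T + (hausdorff2 (A \<inter> F) + hausdorff2 (A - F)) \<le> T + hausdorff2 A"
    by (intro LIMSEQ_le_const2) auto
  then show ?thesis
    using \<open>(\<Sum>n. hausdorff2 (R n)) < top\<close> by (auto simp: T_def ennreal_add_left_cancel_le)
qed

lemma emeasure_area_measure:
  assumes "A \<in> sets borel"
  shows "emeasure area_measure A = hausdorff2 A"
proof -
  let ?H = "hausdorff2 :: (real^3) set \<Rightarrow> ennreal"
  have "outer_measure_space (Pow UNIV) ?H"
    by (auto simp: outer_measure_space_def positive_def increasing_def countably_subadditive_def
        intro: hausdorff2_mono hausdorff2_subadd)
  then have L: "measure_space UNIV (lambda_system UNIV (Pow UNIV) ?H) ?H"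
    by (intro sigma_algebra.caratheodory_lemma sigma_algebra_Pow)
  have "{S. closed S} \<subseteq> lambda_system UNIV (Pow UNIV) ?H"
  proof safe
    fix S :: "(real^3) set" assume "closed S"
    have "?H (S \<inter> X) + ?H ((UNIV - S) \<inter> X) = ?H X" for X
    proof (rule antisym)
      have "(UNIV - S) \<inter> X = X - S" by blast
      then show "?H (S \<inter> X) + ?H ((UNIV - S) \<inter> X) \<le> ?H X"
        using hausdorff2_closed_split[OF \<open>closed S\<close>, of X] by (simp add: Int_commute)
      have "X = S \<inter> X \<union> (UNIV - S) \<inter> X" by blast
      then show "?H X \<le> ?H (S \<inter> X) + ?H ((UNIV - S) \<inter> X)"
        by (metis hausdorff2_Un)
    qed
    then show "S \<in> lambda_system UNIV (Pow UNIV) ?H"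
      by (simp add: lambda_system_def)
  qed
  then have "sets borel \<subseteq> lambda_system UNIV (Pow UNIV) ?H"
    using L unfolding borel_eq_closed measure_space_def
    by (simp add: sigma_algebra.sigma_sets_subset)
  then have "measure_space UNIV (sets borel) ?H"
    using sets.sigma_algebra_axioms[of "borel :: (real^3) measure"]
    by (intro measure_down[OF L]) auto
  then show ?thesis
    unfolding area_measure_def
    by (intro emeasure_measure_of_sigma)
      (use assms in \<open>auto simp: measure_space_def\<close>)
qed

text \<open>A compact \<open>C\<^sup>1\<close> surface without boundary in Euclidean three-space (a time slice), together
  with a continuous unit normal field; \<open>\<phi>' u\<close> is the derivative of the local parametrisation \<open>\<phi>\<close>.\<close>

definition closed_surface :: "(real^3) set \<Rightarrow> (real^3 \<Rightarrow> real^3) \<Rightarrow> bool" where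
  "closed_surface S n \<longleftrightarrow>
     compact S \<and> continuous_on S n \<and> (\<forall>x\<in>S. norm (n x) = 1) \<and>
     (\<forall>p\<in>S. \<exists>U V (\<phi> :: real^2 \<Rightarrow> real^3) g \<phi>'.
        open U \<and> open V \<and> p \<in> V \<and> homeomorphism U (S \<inter> V) \<phi> g \<and>
        (\<forall>u\<in>U. (\<phi> has_derivative \<phi>' u) (at u) \<and> inj (\<phi>' u) \<and> (\<forall>h. n (\<phi> u) \<bullet> \<phi>' u h = 0)) \<and>
        (\<forall>h. continuous_on U (\<lambda>u. \<phi>' u h)))"

text \<open>The integral of \<open>v\<^sup>i d\<Sigma>\<^sub>i\<close> over \<open>S\<close>, where \<open>d\<Sigma>\<^sub>i = n\<^sub>i dA\<close>.\<close>

definition flux ::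
  "(real^3) set \<Rightarrow> (real^3 \<Rightarrow> real^3) \<Rightarrow> (3 \<Rightarrow> real^3 \<Rightarrow> 'b::{banach, second_countable_topology}) \<Rightarrow> 'b" where
  "flux S n v = (LINT x:S|area_measure. (\<Sum>i\<in>UNIV. (n x $ i) *\<^sub>R v i x))"

definition flux_converges ::
  "(real^3) set \<Rightarrow> (real^3 \<Rightarrow> real^3) \<Rightarrow> (3 \<Rightarrow> real^3 \<Rightarrow> 'b::{banach, second_countable_topology}) \<Rightarrow> bool" where
  "flux_converges S n v \<longleftrightarrow> set_integrable area_measure S (\<lambda>x. \<Sum>i\<in>UNIV. (n x $ i) *\<^sub>R v i x)"

text \<open>Round spheres, with outward unit normal \<^const>\<open>sgn\<close>, are closed surfaces.\<close>

lemma closed_surface_sphere: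
  assumes "0 < r"
  shows "closed_surface (sphere 0 r) sgn"
proof -
  have "\<exists>U V (\<phi> :: real^2 \<Rightarrow> real^3) g \<phi>'.
      open U \<and> open V \<and> p \<in> V \<and> homeomorphism U (sphere 0 r \<inter> V) \<phi> g \<and>
      (\<forall>u\<in>U. (\<phi> has_derivative \<phi>' u) (at u) \<and> inj (\<phi>' u) \<and> (\<forall>h. sgn (\<phi> u) \<bullet> \<phi>' u h = 0)) \<and>
      (\<forall>h. continuous_on U (\<lambda>u. \<phi>' u h))"
    if "p \<in> sphere 0 r" for p :: "real^3"
  proof -
    have "norm (axis 3 r :: real^3) = norm p"
      using that assms by (simp add: norm_eq_sqrt_inner inner_axis_axis)
    then obtain T where T: "orthogonal_transformation T" "T (axis 3 r :: real^3) = p"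
      by (rule orthogonal_transformation_exists)
    define T' where "T' = inv T"
    have T': "orthogonal_transformation T'" "\<And>x. T (T' x) = x" "\<And>x. T' (T x) = x"
      using orthogonal_transformation_inv[OF T(1)] orthogonal_transformation_bij[OF T(1)]
      by (auto simp: T'_def bij_is_inj bij_is_surj surj_f_inv_f)
    have bl: "bounded_linear T" "bounded_linear T'"
      using T(1) T'(1) by (simp_all add: orthogonal_transformation_linear linear_conv_bounded_linear[symmetric])
    have inner_T: "T x \<bullet> T y = x \<bullet> y" for x y
      using T(1) by (simp add: orthogonal_transformation_def)
    define E where "E = (\<lambda>a b c. a *\<^sub>R axis 1 1 + b *\<^sub>R axis 2 1 + c *\<^sub>R axis 3 1 :: real^3)"
    have E_nth: "E a b c $ 1 = a" "E a b c $ 2 = b" "E a b c $ 3 = c" for a b c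
      by (simp_all add: E_def axis_def)
    have inner_E: "E a b c \<bullet> E a' b' c' = a * a' + b * b' + c * c'" for a b c a' b' c'
      by (simp add: inner_vec_def sum_3 E_nth)
    define q where "q = (\<lambda>u::real^2. sqrt (r\<^sup>2 - u \<bullet> u))"
    define \<phi> where "\<phi> = (\<lambda>u::real^2. T (E (u $ 1) (u $ 2) (q u)))"
    define \<phi>' where "\<phi>' = (\<lambda>u h::real^2. T (E (h $ 1) (h $ 2) (- (u \<bullet> h) / q u)))"
    define g where "g = (\<lambda>y. (T' y $ 1) *\<^sub>R axis 1 1 + (T' y $ 2) *\<^sub>R axis 2 1 :: real^2)"
    define U where "U = ball (0::real^2) r"
    define V where "V = {y. 0 < T' y $ 3}"
    have inner2: "u \<bullet> v = u $ 1 * v $ 1 + u $ 2 * v $ 2" for u v :: "real^2"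
      by (simp add: inner_vec_def sum_2)
    have U_pos: "0 < r\<^sup>2 - u \<bullet> u" if "u \<in> U" for u
      using that assms by (simp add: U_def dot_square_norm power_strict_mono)
    then have q_pos: "0 < q u" if "u \<in> U" for u using that by (simp add: q_def)
    have q_sq: "q u * q u = r\<^sup>2 - u \<bullet> u" if "u \<in> U" for u
      using U_pos[OF that] by (simp add: q_def)
    have norm_phi: "norm (\<phi> u) = r" if "u \<in> U" for u
      using assms q_sq[OF that]
      by (simp add: norm_eq_sqrt_inner \<phi>_def inner_T inner_E inner2)
    have deriv: "(\<phi> has_derivative \<phi>' u) (at u)" if "u \<in> U" for u
    proof -
      have "(q has_derivative (\<lambda>h. - (u \<bullet> h) / q u)) (at u)"
        unfolding q_def using U_pos[OF that]
        by (auto intro!: derivative_eq_intros simp: fun_eq_iff inner_commute divide_simps)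
      then have "((\<lambda>u. E (u $ 1) (u $ 2) (q u)) has_derivative
          (\<lambda>h. E (h $ 1) (h $ 2) (- (u \<bullet> h) / q u))) (at u)"
        unfolding E_def
        by (intro has_derivative_add has_derivative_scaleR_left bounded_linear_imp_has_derivative
            bounded_linear_vec_nth)
      then show ?thesis
        unfolding \<phi>_def \<phi>'_def by (rule bounded_linear.has_derivative[OF bl(1)])
    qed
    have "inj (\<phi>' u)" for u
    proof (rule injI)
      fix h k assume "\<phi>' u h = \<phi>' u k"
      then have "E (h $ 1) (h $ 2) (- (u \<bullet> h) / q u) = E (k $ 1) (k $ 2) (- (u \<bullet> k) / q u)"
        unfolding \<phi>'_def using T'(3) by metis
      then have "h $ 1 = k $ 1" "h $ 2 = k $ 2" by (metis E_nth)+
      then show "h = k" by (simp add: vec_eq_iff forall_2)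
    qed
    moreover have "sgn (\<phi> u) \<bullet> \<phi>' u h = 0" if "u \<in> U" for u h
      using q_pos[OF that]
      by (simp add: sgn_div_norm \<phi>_def \<phi>'_def inner_T inner_E inner2)
    moreover have "continuous_on U (\<lambda>u. \<phi>' u h)" for h
      unfolding \<phi>'_def E_def using q_pos U_pos
      by (intro bounded_linear.continuous_on[OF bl(1)] continuous_intros)
        (force simp: q_def intro!: continuous_intros)+
    moreover have "homeomorphism U (sphere 0 r \<inter> V) \<phi> g"
    proof (rule homeomorphismI)
      show "continuous_on U \<phi>"
        using deriv by (meson has_derivative_continuous continuous_at_imp_continuous_on)
      show "continuous_on (sphere 0 r \<inter> V) g"
        unfolding g_def by (intro continuous_intros bounded_linear.continuous_on[OF bl(2)])
      show "\<phi> ` U \<subseteq> sphere 0 r \<inter> V"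
        using norm_phi q_pos by (auto simp: V_def \<phi>_def T'(3) E_nth)
      have g_phi: "g (\<phi> u) = u" for u
        by (simp add: g_def \<phi>_def T'(3) E_nth vec_eq_iff forall_2 axis_def)
      show "g (\<phi> u) = u" if "u \<in> U" for u by (rule g_phi)
      have *: "g y \<in> U \<and> \<phi> (g y) = y" if y: "y \<in> sphere 0 r \<inter> V" for y
      proof -
        have gy: "g y $ 1 = T' y $ 1" "g y $ 2 = T' y $ 2"
          by (simp_all add: g_def axis_def)
        have "T' y \<bullet> T' y = r\<^sup>2"
          using y orthogonal_transformation_norm[OF T'(1), of y] by (simp add: dot_square_norm)
        then have sq: "(T' y $ 1) * (T' y $ 1) + (T' y $ 2) * (T' y $ 2) + (T' y $ 3) * (T' y $ 3) = r\<^sup>2"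
          by (simp add: inner_vec_def sum_3)
        have pos: "0 < T' y $ 3" using y by (simp add: V_def)
        have gg: "g y \<bullet> g y = r\<^sup>2 - (T' y $ 3)\<^sup>2"
          using sq by (simp add: inner2 gy power2_eq_square)
        then have "(norm (g y))\<^sup>2 < r\<^sup>2" using pos by (simp add: dot_square_norm)
        then have "g y \<in> U" using assms by (simp add: U_def power2_less_imp_less)
        moreover have "q (g y) = T' y $ 3" using pos by (simp add: q_def gg)
        then have "E (g y $ 1) (g y $ 2) (q (g y)) = T' y"
          by (simp add: vec_eq_iff forall_3 E_nth gy)
        then have "\<phi> (g y) = y" by (simp add: \<phi>_def T'(2))
        ultimately show ?thesis by simp
      qed
      then show "g ` (sphere 0 r \<inter> V) \<subseteq> U" by auto
      show "\<phi> (g y) = y" if "y \<in> sphere 0 r \<inter> V" for y using * that by blast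
    qed
    moreover have "open V"
      unfolding V_def by (intro open_Collect_less continuous_intros bounded_linear.continuous_on[OF bl(2)])
    moreover have "p \<in> V"
      using T'(3)[of "axis 3 r :: real^3"] T(2) assms by (simp add: V_def axis_def)
    moreover have "open U" by (simp add: U_def)
    ultimately show ?thesis
      by (intro exI[of _ U] exI[of _ V] exI[of _ \<phi>] exI[of _ g] exI[of _ \<phi>'] conjI ballI allI)
        (simp_all add: deriv)
  qed
  moreover have "continuous_on (sphere 0 r) (sgn :: real^3 \<Rightarrow> real^3)"
    using assms unfolding sgn_div_norm by (intro continuous_intros) auto
  ultimately show ?thesis
    using assms unfolding closed_surface_def by (auto simp: norm_sgn)
qed


section \<open>Flux integrals of the fields at time \<open>t\<close>\<close>

type_synonym connection = "real^4 \<Rightarrow> 4 \<Rightarrow> 4 \<Rightarrow> 4 \<Rightarrow> real"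
type_synonym field_strength = "real^4 \<Rightarrow> 4 \<Rightarrow> 4 \<Rightarrow> real"

definition density_P :: "connection \<Rightarrow> real \<Rightarrow> 4 \<Rightarrow> 3 \<Rightarrow> real^3 \<Rightarrow> real" where
  "density_P \<omega> t \<kappa> i x = omega_bracket (\<omega> (event t x)) 0 (sp i) \<kappa>"

definition density_K :: "connection \<Rightarrow> real \<Rightarrow> 4 \<Rightarrow> 3 \<Rightarrow> real^3 \<Rightarrow> real" where
  "density_K \<omega> t \<kappa> i x = (\<Sum>j\<in>UNIV. \<Sum>k\<in>UNIV. eps3 i j k * \<omega> (event t x) \<kappa> (sp j) (sp k))"

definition density_U :: "field_strength \<Rightarrow> real \<Rightarrow> 3 \<Rightarrow> real^3 \<Rightarrow> real" where
  "density_U F t i x = raise2 (F (event t x)) 0 (sp i)"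

definition density_V :: "field_strength \<Rightarrow> real \<Rightarrow> 3 \<Rightarrow> real^3 \<Rightarrow> real" where
  "density_V F t i x = (\<Sum>j\<in>UNIV. \<Sum>k\<in>UNIV. eps3 i j k * F (event t x) (sp j) (sp k))"

definition charge_P :: "connection \<Rightarrow> real \<Rightarrow> (real^3) set \<Rightarrow> (real^3 \<Rightarrow> real^3) \<Rightarrow> 4 \<Rightarrow> real" where
  "charge_P \<omega> t S n \<kappa> = 1 / (8 * pi) * flux S n (density_P \<omega> t \<kappa>)"

definition charge_K :: "connection \<Rightarrow> real \<Rightarrow> (real^3) set \<Rightarrow> (real^3 \<Rightarrow> real^3) \<Rightarrow> 4 \<Rightarrow> real" where
  "charge_K \<omega> t S n \<kappa> = 1 / (8 * pi) * flux S n (density_K \<omega> t \<kappa>)"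

definition charge_U :: "field_strength \<Rightarrow> real \<Rightarrow> (real^3) set \<Rightarrow> (real^3 \<Rightarrow> real^3) \<Rightarrow> real" where
  "charge_U F t S n = - 1 / (4 * pi) * flux S n (density_U F t)"

definition charge_V :: "field_strength \<Rightarrow> real \<Rightarrow> (real^3) set \<Rightarrow> (real^3 \<Rightarrow> real^3) \<Rightarrow> real" where
  "charge_V F t S n = 1 / (8 * pi) * flux S n (density_V F t)"

definition charges_converge ::
  "connection \<Rightarrow> field_strength \<Rightarrow> real \<Rightarrow> (real^3) set \<Rightarrow> (real^3 \<Rightarrow> real^3) \<Rightarrow> bool" where
  "charges_converge \<omega> F t S n \<longleftrightarrow>
     (\<forall>\<kappa>. flux_converges S n (density_P \<omega> t \<kappa>)) \<and> (\<forall>\<kappa>. flux_converges S n (density_K \<omega> t \<kappa>)) \<and>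
     flux_converges S n (density_U F t) \<and> flux_converges S n (density_V F t)"

definition nester_0i ::
  "(4 \<Rightarrow> real^4^4) \<Rightarrow> complex^4 \<Rightarrow> connection \<Rightarrow> field_strength \<Rightarrow> real \<Rightarrow> 3 \<Rightarrow> real^3 \<Rightarrow> complex" where
  "nester_0i \<gamma> \<psi> \<omega> F t i x = witten_nester \<gamma> \<psi> (\<omega> (event t x)) (F (event t x)) 0 (sp i)"

end

(* Expanding in components, every product of gamma matrices is, up to sign, one of the sixteen ordered
   monomials of the Clifford algebra, so both bilinear identities hold already between matrices and
   can be compared monomial by monomial.  The flux formula is then linearity of the integral, with
   signs coming from \<epsilon>^{0ijk} = - \<epsilon>^{ijk} and from gamma_5 anticommuting with
   each gamma^\<lambda>. *)

theory Submission
  imports Defs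
begin

section \<open>Spacetime indices as the values 0, 1, 2, 3\<close>

lemma four_eq_zero: "(4::4) = 0"
  by simp

text \<open>The standard expansion runs over 1, 2, 3, 4; in type \<open>4\<close> the last value is
  the time index \<open>0\<close>, which is put first here.\<close>

lemma sum_UNIV_4: "(\<Sum>i\<in>(UNIV::4 set). f i) = f 0 + f 1 + f 2 + f 3"
  using sum_4[of f] unfolding four_eq_zero by (simp add: ac_simps)

lemma forall_index_4: "(\<forall>i::4. P i) \<longleftrightarrow> P 0 \<and> P 1 \<and> P 2 \<and> P 3"
  using forall_4[of P] unfolding four_eq_zero by auto

text \<open>Orients the exchange rules, so that the simplifier sorts indices and stops.\<close>

definition index_less :: "4 \<Rightarrow> 4 \<Rightarrow> bool" where
  "index_less a b \<longleftrightarrow> (a = 0 \<and> b \<noteq> 0) \<or> (a = 1 \<and> (b = 2 \<or> b = 3)) \<or> (a = 2 \<and> b = 3)"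

section \<open>Alternating symbols in dimensions four and three\<close>

definition perm_sign :: "('a::finite \<Rightarrow> 'a) \<Rightarrow> real" where
  "perm_sign p = (if p permutes UNIV then of_int (sign p) else 0)"

lemma perm_sign_id: "perm_sign id = 1"
  by (simp add: perm_sign_def permutes_id)

text \<open>A transposition is invertible, so composing with it preserves and reflects being a
  permutation. For permutations the sign is multiplicative; for all other \<open>p\<close> both
  sides are zero.\<close>

lemma perm_sign_comp_transpose:
  assumes "a \<noteq> b"
  shows "perm_sign (p \<circ> Transposition.transpose a b) = - perm_sign p"
proof -
  have "p \<circ> Transposition.transpose a b permutes UNIV \<longleftrightarrow> p permutes UNIV"
    by (meson bij_imp_permutes bij_swap_iff iso_tuple_UNIV_I permutes_imp_bij)
  moreover have "sign (p \<circ> Transposition.transpose a b) = - sign p" if "p permutes UNIV"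
    using that assms permutation_permutes[of p]
    by (subst sign_compose) (auto simp: sign_swap_id permutation_swap_id)
  ultimately show ?thesis
    by (simp add: perm_sign_def)
qed

text \<open>With entries of type \<open>4\<close> this is a self-map of the index set, and
  exchanging two indices of a symbol becomes composition with a transposition of positions.\<close>

definition row4 :: "'a \<Rightarrow> 'a \<Rightarrow> 'a \<Rightarrow> 'a \<Rightarrow> 4 \<Rightarrow> 'a" where
  "row4 x y z w = (\<lambda>a. if a = 0 then x else if a = 1 then y else if a = 2 then z else w)"

definition row3 :: "'a \<Rightarrow> 'a \<Rightarrow> 'a \<Rightarrow> 3 \<Rightarrow> 'a" where
  "row3 x y z = (\<lambda>a. if a = 1 then x else if a = 2 then y else z)"

text \<open>Expressing both symbols through \<open>perm_sign\<close> lets one sign rule give the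
  antisymmetry in either dimension.\<close>

lemma eps_down_perm_sign: "eps_down \<mu> \<nu> \<rho> \<sigma> = perm_sign (row4 \<mu> \<nu> \<rho> \<sigma>)"
  by (simp add: eps_down_def perm_sign_def row4_def Let_def)

lemma eps3_perm_sign: "eps3 i j k = perm_sign (row3 i j k)"
  by (simp add: eps3_def perm_sign_def row3_def Let_def)

lemma eps_down_0123: "eps_down 0 1 2 3 = 1"
proof -
  have "row4 0 1 2 3 = id"
    unfolding fun_eq_iff forall_index_4 by (simp add: row4_def)
  then show ?thesis
    by (simp add: eps_down_perm_sign perm_sign_id)
qed

lemma eps_down_swap:
  "eps_down \<nu> \<mu> \<rho> \<sigma> = - eps_down \<mu> \<nu> \<rho> \<sigma>"
  "eps_down \<mu> \<rho> \<nu> \<sigma> = - eps_down \<mu> \<nu> \<rho> \<sigma>"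
  "eps_down \<mu> \<nu> \<sigma> \<rho> = - eps_down \<mu> \<nu> \<rho> \<sigma>"
proof -
  have "row4 \<nu> \<mu> \<rho> \<sigma> = row4 \<mu> \<nu> \<rho> \<sigma> \<circ> Transposition.transpose 0 1"
    "row4 \<mu> \<rho> \<nu> \<sigma> = row4 \<mu> \<nu> \<rho> \<sigma> \<circ> Transposition.transpose 1 2"
    "row4 \<mu> \<nu> \<sigma> \<rho> = row4 \<mu> \<nu> \<rho> \<sigma> \<circ> Transposition.transpose 2 3"
    unfolding fun_eq_iff forall_index_4 by (simp_all add: row4_def Transposition.transpose_def)
  then show
    "eps_down \<nu> \<mu> \<rho> \<sigma> = - eps_down \<mu> \<nu> \<rho> \<sigma>"
    "eps_down \<mu> \<rho> \<nu> \<sigma> = - eps_down \<mu> \<nu> \<rho> \<sigma>"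
    "eps_down \<mu> \<nu> \<sigma> \<rho> = - eps_down \<mu> \<nu> \<rho> \<sigma>"
    by (simp_all add: eps_down_perm_sign perm_sign_comp_transpose)
qed

text \<open>Antisymmetry makes these values equal to their own negatives. Adjacent repetitions are
  enough, because sorting brings equal indices together.\<close>

lemma eps_down_repeat:
  "eps_down \<mu> \<mu> \<rho> \<sigma> = 0" "eps_down \<mu> \<nu> \<nu> \<sigma> = 0" "eps_down \<mu> \<nu> \<rho> \<rho> = 0"
  using eps_down_swap(1)[of \<mu> \<mu> \<rho> \<sigma>] eps_down_swap(2)[of \<mu> \<nu> \<nu> \<sigma>] eps_down_swap(3)[of \<mu> \<nu> \<rho> \<rho>]
  by simp_all

lemma eps_down_sort:
  "index_less \<mu> \<nu> \<Longrightarrow> eps_down \<nu> \<mu> \<rho> \<sigma> = - eps_down \<mu> \<nu> \<rho> \<sigma>"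
  "index_less \<nu> \<rho> \<Longrightarrow> eps_down \<mu> \<rho> \<nu> \<sigma> = - eps_down \<mu> \<nu> \<rho> \<sigma>"
  "index_less \<rho> \<sigma> \<Longrightarrow> eps_down \<mu> \<nu> \<sigma> \<rho> = - eps_down \<mu> \<nu> \<rho> \<sigma>"
  by (rule eps_down_swap)+

lemmas eps_down_eval = eps_down_0123 eps_down_repeat eps_down_sort index_less_def

lemma eps3_123: "eps3 1 2 3 = 1"
proof -
  have "row3 1 2 3 = (id :: 3 \<Rightarrow> 3)"
    unfolding fun_eq_iff forall_3 by (simp add: row3_def)
  then show ?thesis
    by (simp add: eps3_perm_sign perm_sign_id)
qed

lemma eps3_swap:
  "eps3 j i k = - eps3 i j k"
  "eps3 i k j = - eps3 i j k"
proof -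
  have "row3 j i k = row3 i j k \<circ> Transposition.transpose 1 2"
    "row3 i k j = row3 i j k \<circ> Transposition.transpose 2 3"
    unfolding fun_eq_iff forall_3 by (simp_all add: row3_def Transposition.transpose_def)
  then show "eps3 j i k = - eps3 i j k" "eps3 i k j = - eps3 i j k"
    by (simp_all add: eps3_perm_sign perm_sign_comp_transpose)
qed

lemma eps3_repeat: "eps3 i i k = 0" "eps3 i k k = 0"
  using eps3_swap(1)[of i i k] eps3_swap(2)[of i k k] by simp_all

lemma sp_simps: "sp 1 = 1" "sp 2 = 2" "sp 3 = 3"
  by (simp_all add: sp_def)

text \<open>This is the source of the sign in the flux formula: with lower indices the two symbols
  agree, so with upper indices they differ by a minus sign.\<close>

lemma eps_down_sp: "eps_down 0 (sp i) (sp j) (sp k) = eps3 i j k"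
proof -
  have "\<forall>i j k. eps_down 0 (sp i) (sp j) (sp k) = eps3 i j k"
    unfolding forall_3
    \<comment> \<open>Only the instances of \<open>eps3_swap\<close> that exchange an out-of-order
      pair are supplied, so the rewriting sorts the indices and terminates.\<close>
    by (simp add: sp_simps eps_down_eval eps3_123 eps3_repeat eps3_swap(1)[of 2 1] eps3_swap(1)[of 3 1]
         eps3_swap(1)[of 3 2] eps3_swap(2)[of _ 2 1] eps3_swap(2)[of _ 3 1] eps3_swap(2)[of _ 3 2])
  then show ?thesis by blast
qed

lemma sum_eps_up_sp:
  "(\<Sum>\<rho>\<in>UNIV. \<Sum>\<sigma>\<in>UNIV. eps_up 0 (sp i) \<rho> \<sigma> * T \<rho> \<sigma>) =
    - (\<Sum>j\<in>UNIV. \<Sum>k\<in>UNIV. eps3 i j k * T (sp j) (sp k))"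
proof -
  \<comment> \<open>One swap puts the second time index next to the first, so only spatial values of
    the summed indices contribute.\<close>
  have "eps_down 0 (sp i) 0 \<sigma> = 0" "eps_down 0 (sp i) \<sigma> 0 = 0" for \<sigma>
    using eps_down_swap(2)[of 0 0 "sp i" \<sigma>] eps_down_swap(3)[of 0 "sp i" 0 \<sigma>]
    by (simp_all add: eps_down_repeat)
  then show ?thesis
    by (simp add: sum_UNIV_4 sum_3 eps_up_def eps_down_sp[symmetric] sp_simps)
qed

section \<open>Signs and scalars in products and bilinears\<close>

lemma matrix_minus_left: "(- A) ** B = - (A ** B)" for A :: "'a::ring_1^'n^'m"
  by (simp add: vec_eq_iff matrix_matrix_mult_def sum_negf)

lemma matrix_minus_right: "A ** (- B) = - (A ** B)" for A :: "'a::ring_1^'n^'m"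
  by (simp add: vec_eq_iff matrix_matrix_mult_def sum_negf)

lemma sandwich_scaleR: "sandwich \<gamma> \<psi> (c *\<^sub>R A) = of_real c * sandwich \<gamma> \<psi> A"
  by (simp add: sandwich_def cmat_def matrix_vector_mult_def sum_distrib_left algebra_simps)

lemma sandwich_minus: "sandwich \<gamma> \<psi> (- A) = - sandwich \<gamma> \<psi> A"
  using sandwich_scaleR[of \<gamma> \<psi> "-1" A] by simp

lemma sandwich_zero: "sandwich \<gamma> \<psi> 0 = 0"
  using sandwich_scaleR[of \<gamma> \<psi> 0 0] by simp

text \<open>The metric is diagonal, so a single term of the sum survives. A raised index thus costs
  only a sign, and products of raised gamma matrices remain single words.\<close>

lemma gamma_up_eq: "gamma_up \<gamma> \<alpha> = eta \<alpha> \<alpha> *\<^sub>R \<gamma> \<alpha>"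
proof -
  have "gamma_up \<gamma> \<alpha> = (\<Sum>\<beta>\<in>UNIV. if \<alpha> = \<beta> then eta \<alpha> \<alpha> *\<^sub>R \<gamma> \<alpha> else 0)"
    unfolding gamma_up_def by (rule sum.cong) (auto simp: eta_def)
  then show ?thesis by simp
qed

lemma raise2_eq: "raise2 T \<mu> \<nu> = eta \<mu> \<mu> * eta \<nu> \<nu> * T \<mu> \<nu>"
proof -
  have "raise2 T \<mu> \<nu> = (\<Sum>\<alpha>\<in>UNIV. \<Sum>\<beta>\<in>UNIV. if \<alpha> = \<mu> \<and> \<beta> = \<nu> then eta \<mu> \<mu> * eta \<nu> \<nu> * T \<mu> \<nu> else 0)"
    unfolding raise2_def by (intro sum.cong) (auto simp: eta_def)
  also have "\<dots> = (\<Sum>\<alpha>\<in>UNIV. if \<alpha> = \<mu> then eta \<mu> \<mu> * eta \<nu> \<nu> * T \<mu> \<nu> else 0)"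
    by (intro sum.cong) auto
  finally show ?thesis by simp
qed

section \<open>Clifford words and the two bilinear identities\<close>

context
  fixes \<gamma> :: "4 \<Rightarrow> real^4^4"
  assumes \<gamma>: "gamma_matrices \<gamma>"
begin

lemma gamma_square: "\<gamma> a ** \<gamma> a = eta a a *\<^sub>R mat 1"
proof -
  have "2 *\<^sub>R (\<gamma> a ** \<gamma> a) = 2 *\<^sub>R (eta a a *\<^sub>R mat 1)"
    using \<gamma> unfolding gamma_matrices_def by (metis scaleR_2 scaleR_scaleR)
  then show ?thesis by (simp del: scaleR_scaleR)
qed

lemma gamma_swap:
  assumes "a \<noteq> b"
  shows "\<gamma> b ** \<gamma> a = - (\<gamma> a ** \<gamma> b)"
proof -
  have "\<gamma> b ** \<gamma> a + \<gamma> a ** \<gamma> b = 0"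
    using \<gamma> assms unfolding gamma_matrices_def by (simp add: eta_def)
  then show ?thesis by (simp add: eq_neg_iff_add_eq_0)
qed

text \<open>For distinct indices anticommutation turns the commutator into twice the product,
  cancelling the factor 1/2. What remains is one signed word instead of a difference of two.\<close>

lemma gamma2_up_eq:
  "gamma2_up \<gamma> \<alpha> \<beta> = (if \<alpha> = \<beta> then 0 else (eta \<alpha> \<alpha> * eta \<beta> \<beta>) *\<^sub>R (\<gamma> \<alpha> ** \<gamma> \<beta>))"
  using gamma_swap[of \<alpha> \<beta>]
  by (simp add: gamma2_up_def gamma_up_eq scalar_matrix_assoc[symmetric] matrix_scalar_ac mult.commute
      scaleR_2[symmetric])

text \<open>A rewriting system on right-nested words: neighbours out of order are exchanged and
  equal neighbours contracted. The versions with a tail \<open>B\<close> act inside a longer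
  word.\<close>

lemma gamma_sort:
  "\<gamma> a ** \<gamma> a = eta a a *\<^sub>R mat 1"
  "\<gamma> a ** (\<gamma> a ** B) = eta a a *\<^sub>R B"
  "index_less a b \<Longrightarrow> \<gamma> b ** \<gamma> a = - (\<gamma> a ** \<gamma> b)"
  "index_less a b \<Longrightarrow> \<gamma> b ** (\<gamma> a ** B) = - (\<gamma> a ** (\<gamma> b ** B))"
proof -
  show "\<gamma> a ** \<gamma> a = eta a a *\<^sub>R mat 1" by (rule gamma_square)
  then show "\<gamma> a ** (\<gamma> a ** B) = eta a a *\<^sub>R B"
    by (simp add: matrix_mul_assoc scalar_matrix_assoc[symmetric])
  assume "index_less a b"
  then show "\<gamma> b ** \<gamma> a = - (\<gamma> a ** \<gamma> b)"
    by (intro gamma_swap) (auto simp: index_less_def)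
  then show "\<gamma> b ** (\<gamma> a ** B) = - (\<gamma> a ** (\<gamma> b ** B))"
    by (simp add: matrix_mul_assoc matrix_minus_left)
qed

text \<open>Every word becomes a scalar times one ordered monomial, and the scalar is pulled out of
  \<open>sandwich\<close>. Both sides of an identity are then compared as linear combinations of
  bilinears of such monomials.\<close>

lemmas gamma_word = gamma5_def gamma_up_eq gamma2_up_eq matrix_mul_assoc[symmetric] gamma_sort index_less_def
  matrix_minus_left matrix_minus_right scalar_matrix_assoc[symmetric] matrix_scalar_ac
  sandwich_minus sandwich_scaleR sandwich_zero eta_def

text \<open>Each gamma matrix commutes with its own factor in \<open>gamma5\<close> and anticommutes
  with the other three, giving an odd number of sign changes.\<close>

lemma gamma_up_gamma5: "gamma_up \<gamma> \<kappa> ** gamma5 \<gamma> = - (gamma5 \<gamma> ** gamma_up \<gamma> \<kappa>)"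
proof -
  have "\<forall>\<kappa>. gamma_up \<gamma> \<kappa> ** gamma5 \<gamma> = - (gamma5 \<gamma> ** gamma_up \<gamma> \<kappa>)"
    unfolding forall_index_4 by (simp add: gamma_word)
  then show ?thesis by blast
qed

text \<open>If \<rho> differs from \<alpha> and \<beta>, then \<open>gamma5\<close> times three
  distinct gamma matrices is a single one up to sign; these terms form \<open>omega_bracket\<close>.
  If \<rho> is one of them, a contraction leaves \<open>gamma5\<close> times a single gamma matrix;
  these terms form the dual part.\<close>

lemma nester_E_eq:
  assumes antisym: "\<And>\<alpha> \<beta> \<sigma>. w \<alpha> \<beta> \<sigma> = - w \<beta> \<alpha> \<sigma>"
  shows "nester_E \<gamma> \<psi> w \<mu> \<nu> =
    1 / (8 * pi) * (\<Sum>\<kappa>\<in>UNIV. sandwich \<gamma> \<psi> (gamma_up \<gamma> \<kappa>) * of_real (omega_bracket w \<mu> \<nu> \<kappa>))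
    + 1 / (8 * pi) * (\<Sum>\<kappa>\<in>UNIV. sandwich \<gamma> \<psi> (gamma_up \<gamma> \<kappa> ** gamma5 \<gamma>) *
        of_real (\<Sum>\<rho>\<in>UNIV. \<Sum>\<sigma>\<in>UNIV. eps_up \<mu> \<nu> \<rho> \<sigma> * w \<kappa> \<rho> \<sigma>))"
    (is "_ = _ * ?P + _ * ?Q")
proof -
  have w: "w \<alpha> \<alpha> \<sigma> = 0" "index_less \<alpha> \<beta> \<Longrightarrow> w \<beta> \<alpha> \<sigma> = - w \<alpha> \<beta> \<sigma>" for \<alpha> \<beta> \<sigma>
    using antisym[of \<alpha> \<alpha> \<sigma>] antisym[of \<beta> \<alpha> \<sigma>] by simp_all
  \<comment> \<open>The sum over \<alpha> and \<beta> stays folded while the alternating symbol is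
    evaluated.\<close>
  define G where "G \<rho> \<sigma> = (\<Sum>\<alpha>\<in>UNIV. \<Sum>\<beta>\<in>UNIV.
      of_real (w \<alpha> \<beta> \<sigma>) * sandwich \<gamma> \<psi> (gamma5 \<gamma> ** \<gamma> \<rho> ** gamma2_up \<gamma> \<alpha> \<beta>))" for \<rho> \<sigma>
  have "(\<Sum>\<rho>\<in>UNIV. \<Sum>\<sigma>\<in>UNIV. \<Sum>\<alpha>\<in>UNIV. \<Sum>\<beta>\<in>UNIV. of_real (eps_up \<mu> \<nu> \<rho> \<sigma> * w \<alpha> \<beta> \<sigma>) *
        sandwich \<gamma> \<psi> (gamma5 \<gamma> ** \<gamma> \<rho> ** gamma2_up \<gamma> \<alpha> \<beta>)) =
      (\<Sum>\<rho>\<in>UNIV. \<Sum>\<sigma>\<in>UNIV. of_real (eps_up \<mu> \<nu> \<rho> \<sigma>) * G \<rho> \<sigma>)"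
    by (simp add: G_def sum_distrib_left mult.assoc)
  \<comment> \<open>The 16 pairs of free indices are treated one at a time. For each, at most two
    pairs (\<rho>, \<sigma>) survive, and only then is \<open>G\<close> expanded. The factors 2 turn
    1/(16 pi) into 1/(8 pi).\<close>
  moreover have "\<forall>\<mu> \<nu>. (\<Sum>\<rho>\<in>UNIV. \<Sum>\<sigma>\<in>UNIV. of_real (eps_up \<mu> \<nu> \<rho> \<sigma>) * G \<rho> \<sigma>) =
     2 * (\<Sum>\<kappa>\<in>UNIV. sandwich \<gamma> \<psi> (gamma_up \<gamma> \<kappa>) * of_real (omega_bracket w \<mu> \<nu> \<kappa>))
     + 2 * (\<Sum>\<kappa>\<in>UNIV. sandwich \<gamma> \<psi> (gamma_up \<gamma> \<kappa> ** gamma5 \<gamma>) *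
        of_real (\<Sum>\<rho>\<in>UNIV. \<Sum>\<sigma>\<in>UNIV. eps_up \<mu> \<nu> \<rho> \<sigma> * w \<kappa> \<rho> \<sigma>))"
    unfolding forall_index_4 sum_UNIV_4 omega_bracket_def raise2_eq
    by (intro conjI; simp add: eps_up_def eps_down_eval delta_def;
        simp add: G_def sum_UNIV_4 w gamma_word; simp add: algebra_simps)
  ultimately have eq: "nester_E \<gamma> \<psi> w \<mu> \<nu> = 1 / (16 * pi) * (2 * ?P + 2 * ?Q)"
    unfolding nester_E_def by presburger
  show ?thesis
    unfolding eq distrib_left by simp
qed

text \<open>The symbol forces \<rho> and \<sigma> to be distinct. If \<alpha>, \<beta> are the two
  complementary indices, the four gamma matrices give \<open>gamma5\<close> up to sign, and its
  square is a scalar: this is the \<open>mat 1\<close> term. If they are \<rho>, \<sigma>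
  themselves, everything but \<open>gamma5\<close> contracts. If exactly one index is shared, the
  product is symmetric under exchange of \<rho> and \<sigma> and cancels.\<close>

lemma nester_H_eq:
  assumes antisym: "\<And>\<alpha> \<beta>. f \<alpha> \<beta> = - f \<beta> \<alpha>"
  shows "nester_H \<gamma> \<psi> f \<mu> \<nu> =
    \<i> / (4 * pi) * of_real (raise2 f \<mu> \<nu>) * sandwich \<gamma> \<psi> (mat 1)
    + \<i> / (8 * pi) * of_real (\<Sum>\<rho>\<in>UNIV. \<Sum>\<sigma>\<in>UNIV. eps_up \<mu> \<nu> \<rho> \<sigma> * f \<rho> \<sigma>) *
        sandwich \<gamma> \<psi> (gamma5 \<gamma>)"
    (is "_ = _ + _ * of_real ?R * _")
proof -
  have f: "f \<alpha> \<alpha> = 0" "index_less \<alpha> \<beta> \<Longrightarrow> f \<beta> \<alpha> = - f \<alpha> \<beta>" for \<alpha> \<beta>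
    using antisym[of \<alpha> \<alpha>] antisym[of \<beta> \<alpha>] by simp_all
  define G where "G \<rho> \<sigma> = (\<Sum>\<alpha>\<in>UNIV. \<Sum>\<beta>\<in>UNIV.
      of_real (f \<alpha> \<beta>) * sandwich \<gamma> \<psi> (gamma5 \<gamma> ** \<gamma> \<rho> ** gamma2_up \<gamma> \<alpha> \<beta> ** \<gamma> \<sigma>))" for \<rho> \<sigma>
  have "(\<Sum>\<rho>\<in>UNIV. \<Sum>\<sigma>\<in>UNIV. \<Sum>\<alpha>\<in>UNIV. \<Sum>\<beta>\<in>UNIV. of_real (eps_up \<mu> \<nu> \<rho> \<sigma> * f \<alpha> \<beta>) *
        sandwich \<gamma> \<psi> (gamma5 \<gamma> ** \<gamma> \<rho> ** gamma2_up \<gamma> \<alpha> \<beta> ** \<gamma> \<sigma>)) =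
      (\<Sum>\<rho>\<in>UNIV. \<Sum>\<sigma>\<in>UNIV. of_real (eps_up \<mu> \<nu> \<rho> \<sigma>) * G \<rho> \<sigma>)"
    by (simp add: G_def sum_distrib_left mult.assoc)
  \<comment> \<open>The case check is organised as for the gravitational part; the factors 4 and 2
    become 1/(4 pi) and 1/(8 pi) after division by 16 pi.\<close>
  moreover have "\<forall>\<mu> \<nu>. (\<Sum>\<rho>\<in>UNIV. \<Sum>\<sigma>\<in>UNIV. of_real (eps_up \<mu> \<nu> \<rho> \<sigma>) * G \<rho> \<sigma>) =
     4 * of_real (raise2 f \<mu> \<nu>) * sandwich \<gamma> \<psi> (mat 1)
     + 2 * of_real (\<Sum>\<rho>\<in>UNIV. \<Sum>\<sigma>\<in>UNIV. eps_up \<mu> \<nu> \<rho> \<sigma> * f \<rho> \<sigma>) * sandwich \<gamma> \<psi> (gamma5 \<gamma>)"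
    unfolding forall_index_4 sum_UNIV_4 raise2_eq
    by (intro conjI; simp add: eps_up_def eps_down_eval;
        simp add: G_def sum_UNIV_4 f gamma_word; simp add: algebra_simps)
  ultimately have eq: "nester_H \<gamma> \<psi> f \<mu> \<nu> = \<i> / (16 * pi) *
      (4 * of_real (raise2 f \<mu> \<nu>) * sandwich \<gamma> \<psi> (mat 1) + 2 * of_real ?R * sandwich \<gamma> \<psi> (gamma5 \<gamma>))"
    unfolding nester_H_def by presburger
  show ?thesis
    unfolding eq distrib_left by (simp add: mult_ac del: of_real_sum)
qed

text \<open>The form is displayed as a sum of complex constants times real densities, ready for
  integration term by term. In the \<open>density_K\<close> term the sign of the alternating symbol
  cancels the one from \<open>gamma_up_gamma5\<close>; in the \<open>density_V\<close> term it
  remains.\<close>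

lemma nester_0i_eq:
  assumes w: "\<And>X \<alpha> \<beta> \<sigma>. \<omega> X \<alpha> \<beta> \<sigma> = - \<omega> X \<beta> \<alpha> \<sigma>"
    and f: "\<And>X \<alpha> \<beta>. F X \<alpha> \<beta> = - F X \<beta> \<alpha>"
  shows "nester_0i \<gamma> \<psi> \<omega> F t i x =
    (\<Sum>\<kappa>\<in>UNIV. sandwich \<gamma> \<psi> (gamma_up \<gamma> \<kappa>) / (8 * pi) * of_real (density_P \<omega> t \<kappa> i x))
    + (\<Sum>\<kappa>\<in>UNIV. sandwich \<gamma> \<psi> (gamma5 \<gamma> ** gamma_up \<gamma> \<kappa>) / (8 * pi) * of_real (density_K \<omega> t \<kappa> i x))
    + \<i> * sandwich \<gamma> \<psi> (mat 1) / (4 * pi) * of_real (density_U F t i x)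
    + - (\<i> * sandwich \<gamma> \<psi> (gamma5 \<gamma>)) / (8 * pi) * of_real (density_V F t i x)"
proof -
  have K: "(\<Sum>\<rho>\<in>UNIV. \<Sum>\<sigma>\<in>UNIV. eps_up 0 (sp i) \<rho> \<sigma> * \<omega> (event t x) \<kappa> \<rho> \<sigma>) = - density_K \<omega> t \<kappa> i x" for \<kappa>
    unfolding density_K_def by (rule sum_eps_up_sp)
  have V: "(\<Sum>\<rho>\<in>UNIV. \<Sum>\<sigma>\<in>UNIV. eps_up 0 (sp i) \<rho> \<sigma> * F (event t x) \<rho> \<sigma>) = - density_V F t i x"
    unfolding density_V_def by (rule sum_eps_up_sp)
  show ?thesis
    unfolding nester_0i_def witten_nester_def nester_E_eq[OF w] nester_H_eq[OF f] K V gamma_up_gamma5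
      sandwich_minus density_P_def[symmetric] density_U_def[symmetric]
    by (simp add: sum_distrib_left mult_ac)
qed

end

section \<open>Linearity of the flux and the charge formula\<close>

definition has_flux ::
  "(real^3) set \<Rightarrow> (real^3 \<Rightarrow> real^3) \<Rightarrow> (3 \<Rightarrow> real^3 \<Rightarrow> 'b::{banach, second_countable_topology}) \<Rightarrow> 'b \<Rightarrow> bool"
  where "has_flux S n v b \<longleftrightarrow>
    has_bochner_integral area_measure (\<lambda>x. indicator S x *\<^sub>R (\<Sum>i\<in>UNIV. (n x $ i) *\<^sub>R v i x)) b"

text \<open>Convergence and value are held in one relation, so each linearity rule transports both
  at once.\<close>

lemma has_flux_iff: "has_flux S n v b \<longleftrightarrow> flux_converges S n v \<and> flux S n v = b"
  unfolding has_flux_def flux_converges_def flux_def set_integrable_def set_lebesgue_integral_def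
  by (rule has_bochner_integral_iff)

lemma has_flux_add:
  assumes "has_flux S n u a" "has_flux S n v b"
  shows "has_flux S n (\<lambda>i x. u i x + v i x) (a + b)"
  using has_bochner_integral_add[OF assms[unfolded has_flux_def]]
  by (simp add: has_flux_def scaleR_add_right sum.distrib)

lemma has_flux_sum:
  assumes "\<And>k. k \<in> I \<Longrightarrow> has_flux S n (v k) (b k)"
  shows "has_flux S n (\<lambda>i x. \<Sum>k\<in>I. v k i x) (\<Sum>k\<in>I. b k)"
proof -
  have "(\<Sum>k\<in>I. indicator S x *\<^sub>R (\<Sum>i\<in>UNIV. (n x $ i) *\<^sub>R v k i x)) =
      indicator S x *\<^sub>R (\<Sum>i\<in>UNIV. (n x $ i) *\<^sub>R (\<Sum>k\<in>I. v k i x))" for x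
    unfolding scaleR_sum_right[symmetric] by (subst sum.swap) (simp add: scaleR_sum_right)
  moreover have "has_bochner_integral area_measure
      (\<lambda>x. \<Sum>k\<in>I. indicator S x *\<^sub>R (\<Sum>i\<in>UNIV. (n x $ i) *\<^sub>R v k i x)) (\<Sum>k\<in>I. b k)"
    by (intro has_bochner_integral_sum) (use assms in \<open>simp add: has_flux_def\<close>)
  ultimately show ?thesis by (simp add: has_flux_def)
qed

lemma has_flux_bounded_linear:
  assumes T: "bounded_linear T" and v: "has_flux S n v b"
  shows "has_flux S n (\<lambda>i x. T (v i x)) (T b)"
proof -
  interpret bounded_linear T by (rule T)
  show ?thesis
    using has_bochner_integral_bounded_linear[OF T v[unfolded has_flux_def]]
    by (simp add: has_flux_def sum scaleR)
qed

text \<open>Passes from real densities to complex ones: multiplying an embedded real by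
  \<open>c\<close> is a bounded real-linear map.\<close>

lemma has_flux_mult_of_real:
  fixes c :: complex
  assumes "has_flux S n v b"
  shows "has_flux S n (\<lambda>i x. c * of_real (v i x)) (c * of_real b)"
  by (intro has_flux_bounded_linear[OF _ assms] bounded_linear_const_mult bounded_linear_of_real)

lemma has_flux_nester_0i:
  assumes \<gamma>: "gamma_matrices \<gamma>"
    and w: "\<And>X \<alpha> \<beta> \<sigma>. \<omega> X \<alpha> \<beta> \<sigma> = - \<omega> X \<beta> \<alpha> \<sigma>"
    and f: "\<And>X \<alpha> \<beta>. F X \<alpha> \<beta> = - F X \<beta> \<alpha>"
    and conv: "charges_converge \<omega> F t S n"
  shows "has_flux S n (nester_0i \<gamma> \<psi> \<omega> F t)
    ((\<Sum>\<kappa>\<in>UNIV. sandwich \<gamma> \<psi> (gamma_up \<gamma> \<kappa>) * of_real (charge_P \<omega> t S n \<kappa>))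
     + (\<Sum>\<kappa>\<in>UNIV. sandwich \<gamma> \<psi> (gamma5 \<gamma> ** gamma_up \<gamma> \<kappa>) * of_real (charge_K \<omega> t S n \<kappa>))
     - \<i> * of_real (charge_U F t S n) * sandwich \<gamma> \<psi> (mat 1)
     - \<i> * of_real (charge_V F t S n) * sandwich \<gamma> \<psi> (gamma5 \<gamma>))" (is "has_flux S n _ ?Q")
proof -
  have *: "has_flux S n (density_P \<omega> t \<kappa>) (flux S n (density_P \<omega> t \<kappa>))"
    "has_flux S n (density_K \<omega> t \<kappa>) (flux S n (density_K \<omega> t \<kappa>))"
    "has_flux S n (density_U F t) (flux S n (density_U F t))"
    "has_flux S n (density_V F t) (flux S n (density_V F t))" for \<kappa>
    using conv by (simp_all add: charges_converge_def has_flux_iff)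
  have "has_flux S n (nester_0i \<gamma> \<psi> \<omega> F t)
    ((\<Sum>\<kappa>\<in>UNIV. sandwich \<gamma> \<psi> (gamma_up \<gamma> \<kappa>) / (8 * pi) * of_real (flux S n (density_P \<omega> t \<kappa>)))
    + (\<Sum>\<kappa>\<in>UNIV. sandwich \<gamma> \<psi> (gamma5 \<gamma> ** gamma_up \<gamma> \<kappa>) / (8 * pi) *
        of_real (flux S n (density_K \<omega> t \<kappa>)))
    + \<i> * sandwich \<gamma> \<psi> (mat 1) / (4 * pi) * of_real (flux S n (density_U F t))
    + - (\<i> * sandwich \<gamma> \<psi> (gamma5 \<gamma>)) / (8 * pi) * of_real (flux S n (density_V F t)))"
    (is "has_flux S n _ ?R")
    unfolding nester_0i_eq[OF \<gamma> w f, abs_def]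
    by (intro has_flux_add has_flux_sum has_flux_mult_of_real *)
  \<comment> \<open>The prefactors 1/(8 pi) and 1/(4 pi) are absorbed into the charges. The minus
    sign in \<open>charge_U\<close> turns the positive Maxwell term into a subtracted one.\<close>
  moreover have "?R = ?Q"
    by (simp add: charge_P_def charge_K_def charge_U_def charge_V_def mult_ac)
  ultimately show ?thesis by simp
qed

text \<open>The integral over the sphere at spatial infinity is encoded as a limit of fluxes through
  round spheres at fixed time, with outward normal \<open>sgn\<close> and charges that converge for
  all large radii.\<close>

theorem mainTheorem8:
  fixes \<gamma> :: "4 \<Rightarrow> real^4^4"
    and \<omega> :: "real^4 \<Rightarrow> 4 \<Rightarrow> 4 \<Rightarrow> 4 \<Rightarrow> real"
    and F :: "real^4 \<Rightarrow> 4 \<Rightarrow> 4 \<Rightarrow> real"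
    and \<epsilon> :: "complex^4"
  assumes "gamma_matrices \<gamma>"
    and "\<forall>X \<alpha> \<beta> \<sigma>. \<omega> X \<alpha> \<beta> \<sigma> = - \<omega> X \<beta> \<alpha> \<sigma>"
    and "\<forall>X \<alpha> \<beta>. F X \<alpha> \<beta> = - F X \<beta> \<alpha>"
  shows
    "(\<forall>X \<mu> \<nu>. nester_E \<gamma> \<epsilon> (\<omega> X) \<mu> \<nu> =
        1 / (8 * pi) * (\<Sum>\<kappa>\<in>UNIV. sandwich \<gamma> \<epsilon> (gamma_up \<gamma> \<kappa>) * of_real (omega_bracket (\<omega> X) \<mu> \<nu> \<kappa>))
        + 1 / (8 * pi) * (\<Sum>\<kappa>\<in>UNIV. sandwich \<gamma> \<epsilon> (gamma_up \<gamma> \<kappa> ** gamma5 \<gamma>) *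
            of_real (\<Sum>\<rho>\<in>UNIV. \<Sum>\<sigma>\<in>UNIV. eps_up \<mu> \<nu> \<rho> \<sigma> * \<omega> X \<kappa> \<rho> \<sigma>)))
     \<and>
     (\<forall>X \<mu> \<nu>. nester_H \<gamma> \<epsilon> (F X) \<mu> \<nu> =
        \<i> / (4 * pi) * of_real (raise2 (F X) \<mu> \<nu>) * sandwich \<gamma> \<epsilon> (mat 1)
        + \<i> / (8 * pi) * of_real (\<Sum>\<rho>\<in>UNIV. \<Sum>\<sigma>\<in>UNIV. eps_up \<mu> \<nu> \<rho> \<sigma> * F X \<rho> \<sigma>) *
            sandwich \<gamma> \<epsilon> (gamma5 \<gamma>))
     \<and>
     (\<forall>t S n. closed_surface S n \<and> charges_converge \<omega> F t S n \<longrightarrow>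
        flux_converges S n (nester_0i \<gamma> \<epsilon> \<omega> F t) \<and>
        flux S n (nester_0i \<gamma> \<epsilon> \<omega> F t) =
          (\<Sum>\<kappa>\<in>UNIV. sandwich \<gamma> \<epsilon> (gamma_up \<gamma> \<kappa>) * of_real (charge_P \<omega> t S n \<kappa>))
          + (\<Sum>\<kappa>\<in>UNIV. sandwich \<gamma> \<epsilon> (gamma5 \<gamma> ** gamma_up \<gamma> \<kappa>) * of_real (charge_K \<omega> t S n \<kappa>))
          - \<i> * of_real (charge_U F t S n) * sandwich \<gamma> \<epsilon> (mat 1)
          - \<i> * of_real (charge_V F t S n) * sandwich \<gamma> \<epsilon> (gamma5 \<gamma>))
     \<and>
     (\<forall>t P K U V.
        (\<forall>\<^sub>F r in at_top. charges_converge \<omega> F t (sphere 0 r) sgn) \<and>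
        (\<forall>\<kappa>. ((\<lambda>r. charge_P \<omega> t (sphere 0 r) sgn \<kappa>) \<longlongrightarrow> P \<kappa>) at_top) \<and>
        (\<forall>\<kappa>. ((\<lambda>r. charge_K \<omega> t (sphere 0 r) sgn \<kappa>) \<longlongrightarrow> K \<kappa>) at_top) \<and>
        ((\<lambda>r. charge_U F t (sphere 0 r) sgn) \<longlongrightarrow> U) at_top \<and>
        ((\<lambda>r. charge_V F t (sphere 0 r) sgn) \<longlongrightarrow> V) at_top \<longrightarrow>
        (\<forall>\<^sub>F r in at_top. flux_converges (sphere 0 r) sgn (nester_0i \<gamma> \<epsilon> \<omega> F t)) \<and>
        ((\<lambda>r. flux (sphere 0 r) sgn (nester_0i \<gamma> \<epsilon> \<omega> F t)) \<longlongrightarrow>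
          (\<Sum>\<kappa>\<in>UNIV. sandwich \<gamma> \<epsilon> (gamma_up \<gamma> \<kappa>) * of_real (P \<kappa>))
          + (\<Sum>\<kappa>\<in>UNIV. sandwich \<gamma> \<epsilon> (gamma5 \<gamma> ** gamma_up \<gamma> \<kappa>) * of_real (K \<kappa>))
          - \<i> * of_real U * sandwich \<gamma> \<epsilon> (mat 1)
          - \<i> * of_real V * sandwich \<gamma> \<epsilon> (gamma5 \<gamma>)) at_top)"
proof (intro conjI allI impI)
  note \<gamma> = assms(1) and w = assms(2)[rule_format] and f = assms(3)[rule_format]
  note E = nester_E_eq[OF \<gamma> w] and H = nester_H_eq[OF \<gamma> f]
  note flux = has_flux_nester_0i[OF \<gamma> w f, where \<psi> = \<epsilon>, unfolded has_flux_iff]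
  show "nester_E \<gamma> \<epsilon> (\<omega> X) \<mu> \<nu> =
      1 / (8 * pi) * (\<Sum>\<kappa>\<in>UNIV. sandwich \<gamma> \<epsilon> (gamma_up \<gamma> \<kappa>) * of_real (omega_bracket (\<omega> X) \<mu> \<nu> \<kappa>))
      + 1 / (8 * pi) * (\<Sum>\<kappa>\<in>UNIV. sandwich \<gamma> \<epsilon> (gamma_up \<gamma> \<kappa> ** gamma5 \<gamma>) *
          of_real (\<Sum>\<rho>\<in>UNIV. \<Sum>\<sigma>\<in>UNIV. eps_up \<mu> \<nu> \<rho> \<sigma> * \<omega> X \<kappa> \<rho> \<sigma>))" for X \<mu> \<nu>
    by (rule E)
  show "nester_H \<gamma> \<epsilon> (F X) \<mu> \<nu> =
      \<i> / (4 * pi) * of_real (raise2 (F X) \<mu> \<nu>) * sandwich \<gamma> \<epsilon> (mat 1)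
      + \<i> / (8 * pi) * of_real (\<Sum>\<rho>\<in>UNIV. \<Sum>\<sigma>\<in>UNIV. eps_up \<mu> \<nu> \<rho> \<sigma> * F X \<rho> \<sigma>) *
          sandwich \<gamma> \<epsilon> (gamma5 \<gamma>)" for X \<mu> \<nu>
    by (rule H)
  fix t
  {
    fix S n assume "closed_surface S n \<and> charges_converge \<omega> F t S n"
    then have conv: "charges_converge \<omega> F t S n" by simp
    show "flux_converges S n (nester_0i \<gamma> \<epsilon> \<omega> F t)"
      using flux[OF conv] by (rule conjunct1)
    show "flux S n (nester_0i \<gamma> \<epsilon> \<omega> F t) =
        (\<Sum>\<kappa>\<in>UNIV. sandwich \<gamma> \<epsilon> (gamma_up \<gamma> \<kappa>) * of_real (charge_P \<omega> t S n \<kappa>))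
        + (\<Sum>\<kappa>\<in>UNIV. sandwich \<gamma> \<epsilon> (gamma5 \<gamma> ** gamma_up \<gamma> \<kappa>) * of_real (charge_K \<omega> t S n \<kappa>))
        - \<i> * of_real (charge_U F t S n) * sandwich \<gamma> \<epsilon> (mat 1)
        - \<i> * of_real (charge_V F t S n) * sandwich \<gamma> \<epsilon> (gamma5 \<gamma>)"
      using flux[OF conv] by (rule conjunct2)
  }
  fix P K U V
  assume lim: "(\<forall>\<^sub>F r in at_top. charges_converge \<omega> F t (sphere 0 r) sgn) \<and>
    (\<forall>\<kappa>. ((\<lambda>r. charge_P \<omega> t (sphere 0 r) sgn \<kappa>) \<longlongrightarrow> P \<kappa>) at_top) \<and>
    (\<forall>\<kappa>. ((\<lambda>r. charge_K \<omega> t (sphere 0 r) sgn \<kappa>) \<longlongrightarrow> K \<kappa>) at_top) \<and>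
    ((\<lambda>r. charge_U F t (sphere 0 r) sgn) \<longlongrightarrow> U) at_top \<and>
    ((\<lambda>r. charge_V F t (sphere 0 r) sgn) \<longlongrightarrow> V) at_top"
  then have conv: "\<forall>\<^sub>F r in at_top. charges_converge \<omega> F t (sphere 0 r) sgn"
    by (rule conjunct1)
  from conv show "\<forall>\<^sub>F r in at_top. flux_converges (sphere 0 r) sgn (nester_0i \<gamma> \<epsilon> \<omega> F t)"
    by eventually_elim (rule flux[THEN conjunct1])
  show "((\<lambda>r. flux (sphere 0 r) sgn (nester_0i \<gamma> \<epsilon> \<omega> F t)) \<longlongrightarrow>
      (\<Sum>\<kappa>\<in>UNIV. sandwich \<gamma> \<epsilon> (gamma_up \<gamma> \<kappa>) * of_real (P \<kappa>))
      + (\<Sum>\<kappa>\<in>UNIV. sandwich \<gamma> \<epsilon> (gamma5 \<gamma> ** gamma_up \<gamma> \<kappa>) * of_real (K \<kappa>))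
      - \<i> * of_real U * sandwich \<gamma> \<epsilon> (mat 1)
      - \<i> * of_real V * sandwich \<gamma> \<epsilon> (gamma5 \<gamma>)) at_top"
  \<comment> \<open>The charge expression is a finite linear combination of the four families of
    charges, so its limit follows from theirs. It equals the flux wherever the charges converge,
    that is, for all large \<open>r\<close>, and the limit carries over.\<close>
  proof (rule Lim_transform_eventually)
    show "((\<lambda>r. (\<Sum>\<kappa>\<in>UNIV. sandwich \<gamma> \<epsilon> (gamma_up \<gamma> \<kappa>) * of_real (charge_P \<omega> t (sphere 0 r) sgn \<kappa>))
        + (\<Sum>\<kappa>\<in>UNIV. sandwich \<gamma> \<epsilon> (gamma5 \<gamma> ** gamma_up \<gamma> \<kappa>) *
            of_real (charge_K \<omega> t (sphere 0 r) sgn \<kappa>))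
        - \<i> * of_real (charge_U F t (sphere 0 r) sgn) * sandwich \<gamma> \<epsilon> (mat 1)
        - \<i> * of_real (charge_V F t (sphere 0 r) sgn) * sandwich \<gamma> \<epsilon> (gamma5 \<gamma>)) \<longlongrightarrow>
      (\<Sum>\<kappa>\<in>UNIV. sandwich \<gamma> \<epsilon> (gamma_up \<gamma> \<kappa>) * of_real (P \<kappa>))
      + (\<Sum>\<kappa>\<in>UNIV. sandwich \<gamma> \<epsilon> (gamma5 \<gamma> ** gamma_up \<gamma> \<kappa>) * of_real (K \<kappa>))
      - \<i> * of_real U * sandwich \<gamma> \<epsilon> (mat 1)
      - \<i> * of_real V * sandwich \<gamma> \<epsilon> (gamma5 \<gamma>)) at_top"
      using lim by (intro tendsto_intros) auto
    from conv show "\<forall>\<^sub>F r in at_top.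
        (\<Sum>\<kappa>\<in>UNIV. sandwich \<gamma> \<epsilon> (gamma_up \<gamma> \<kappa>) * of_real (charge_P \<omega> t (sphere 0 r) sgn \<kappa>))
        + (\<Sum>\<kappa>\<in>UNIV. sandwich \<gamma> \<epsilon> (gamma5 \<gamma> ** gamma_up \<gamma> \<kappa>) *
            of_real (charge_K \<omega> t (sphere 0 r) sgn \<kappa>))
        - \<i> * of_real (charge_U F t (sphere 0 r) sgn) * sandwich \<gamma> \<epsilon> (mat 1)
        - \<i> * of_real (charge_V F t (sphere 0 r) sgn) * sandwich \<gamma> \<epsilon> (gamma5 \<gamma>) =
        flux (sphere 0 r) sgn (nester_0i \<gamma> \<epsilon> \<omega> F t)"
      by eventually_elim (rule flux[THEN conjunct2, symmetric])
  qed
qed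

end
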